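(* Let $I\subset\mathbb{R}$ be an interval and let $\gamma:I\to\mathbb{R}^4$ be a non-degenerate curve parametrized by arc-length $s$, with Frenet frame $\{\mathbf{t},\mathbf{n}_1,\mathbf{n}_2,\mathbf{n}_3\}$ and curvatures $\kappa_1,\kappa_2,\kappa_3$. Let $\lambda$ be a non-zero constant and put $\overline{\gamma}(s)=\gamma(s)+\lambda\mathbf{n}_1(s)$. Then $\gamma$ and $\overline{\gamma}$ are second mates with $\overline{\gamma}(s)=\gamma(s)+\lambda \mathbf{n}_1(s)$ (that is, $\overline\gamma$ is a non-degenerate curve and $\mathbf{n}_1(s)=\pm\overline{\mathbf{n}}_2(s)$ for all $s\in I$) if and only if for all $s\in I$ the following three conditions hold: $$\lambda(\kappa_1^2(s)+\kappa_2^2(s))=\kappa_1(s),$$ \begin{align*} f_1(s) &= \lambda^2 \kappa_1'(s)^2\kappa_2^4(s)\kappa_3^2(s)+(1-\lambda \kappa_1(s))^2\kappa_1'(s)^2\kappa_2^2(s)\kappa_3^2(s) \\ &\quad +\kappa_1'(s)^2\big((1-\lambda \kappa_1(s))\kappa_2'(s)+\lambda \kappa_1'(s) \kappa_2(s)\big)^2 >0, \end{align*} \begin{align*} f_2(s) &= \kappa_2(s)\left(2\kappa_2'(s)^2\kappa_3(s)+\kappa_2(s)\kappa_2'(s)\kappa_3'(s)-\kappa_2(s)\kappa_2''(s)\kappa_3(s)+\kappa_2^2(s)\kappa_3^3(s)\right)\\ &\quad +\kappa_1(s)\left(2\kappa_1'(s)\kappa_2'(s)\kappa_3(s)+\kappa_1'(s)\kappa_2(s)\kappa_3'(s)-\kappa_1''(s)\kappa_2(s)\kappa_3(s)\right)=0.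 \end{align*}
   Context: All maps are $C^\infty$. For $\mathbf{a},\mathbf{b},\mathbf{c}\in\mathbb{R}^4$ the vector product $\mathbf{a}\times\mathbf{b}\times\mathbf{c}\in\mathbb{R}^4$ is the vector with $(\mathbf{a}\times\mathbf{b}\times\mathbf{c})\cdot\mathbf{x}=\det(\mathbf{a},\mathbf{b},\mathbf{c},\mathbf{x})$ for all $\mathbf{x}$. A regular curve $\gamma:I\to\mathbb{R}^4$ ($\dot\gamma(t)\neq0$ for all $t$) is non-degenerate if $\dot\gamma(t)\times\ddot\gamma(t)\times\dddot\gamma(t)\ne0$ for all $t\in I$. The Frenet frame of a non-degenerate curve (in a general parameter $t$) is $$\mathbf{t}=\frac{\dot\gamma}{|\dot\gamma|},\quad \mathbf{n}_1=\frac{\dot{\mathbf{t}}}{|\dot{\mathbf{t}}|},\quad \mathbf{n}_3=\frac{\dot\gamma\times\ddot\gamma\times\dddot\gamma}{|\dot\gamma\times\ddot\gamma\times\dddot\gamma|},\quad \mathbf{n}_2=-\mathbf{n}_3\times\mathbf{t}\times\mathbf{n}_1,$$ and its curvatures $\kappa_1>0$, $\kappa_2>0$, $\kappa_3$ are determined by $\dot{\mathbf{t}}=|\dot\gamma|\kappa_1\mathbf{n}_1$, $\dot{\mathbf{n}}_1=|\dot\gamma|(-\kappa_1\mathbf{t}+\kappa_2\mathbf{n}_2)$, $\dot{\mathbf{n}}_2=|\dot\gamma|(-\kappa_2\mathbf{n}_1+\kappa_3\mathbf{n}_3)$, $\dot{\mathbf{n}}_3=-|\dot\gamma|\kappa_3\mathbf{n}_2$.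 Objects of $\overline\gamma$ (computed with the same parameter, which need not be arc-length for $\overline\gamma$) are denoted with a bar; $'$ denotes $d/ds$. Definition. Different non-degenerate curves $\gamma,\overline\gamma:I\to\mathbb{R}^4$ are second mates (second type of Mannheim mates) if there is a smooth function $\lambda:I\to\mathbb{R}$ with $\overline\gamma(t)=\gamma(t)+\lambda(t)\mathbf{n}_1(t)$ and $\mathbf{n}_1(t)=\pm\overline{\mathbf{n}}_2(t)$ for all $t\in I$. *)

theory Defs
  imports "HOL-Analysis.Analysis"
begin

text \<open>
  Derivatives are taken within the parameter interval, so at an endpoint that belongs to the
  interval they are the one-sided ones.
\<close>

definition deriv_on :: "real set \<Rightarrow> (real \<Rightarrow> 'a::real_normed_vector) \<Rightarrow> real \<Rightarrow> 'a" where
  "deriv_on I f t = vector_derivative f (at t within I)"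

definition smooth_on :: "real set \<Rightarrow> (real \<Rightarrow> 'a::real_normed_vector) \<Rightarrow> bool" where
  "smooth_on I f \<longleftrightarrow> (\<forall>k. \<forall>t\<in>I. ((deriv_on I ^^ k) f) differentiable (at t within I))"

definition cross4 :: "real^4 \<Rightarrow> real^4 \<Rightarrow> real^4 \<Rightarrow> real^4" where
  "cross4 a b c = (\<chi> i. det (vector [a, b, c, axis i 1] :: real^4^4))"

text \<open>The property \<open>cross4_inner\<close> below characterizes the vector product.\<close>

lemma vector_4_rows:
  "(vector [a, b, c, d] :: ('a::zero)^4) $ 1 = a"
  "(vector [a, b, c, d] :: ('a::zero)^4) $ 2 = b"
  "(vector [a, b, c, d] :: ('a::zero)^4) $ 3 = c"
  "(vector [a, b, c, d] :: ('a::zero)^4) $ 4 = d"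
  by (simp_all add: vector_def)

lemma cross4_inner:
  "cross4 a b c \<bullet> x = det (vector [a, b, c, x] :: real^4^4)"
proof -
  let ?r = "\<lambda>i::4. (vector [a, b, c, 0] :: real^4^4) $ i"
  have rows: "(vector [a, b, c, y] :: real^4^4) = (\<chi> i. if i = 4 then y else ?r i)" for y
    by (simp add: vec_eq_iff[where x = "vector [a, b, c, y]"] forall_4 vector_4_rows)
  have "det (\<chi> i. if i = 4 then (\<Sum>j\<in>UNIV. x $ j *s axis j 1) else ?r i)
      = (\<Sum>j\<in>UNIV. det (\<chi> i. if i = 4 then x $ j *s axis j 1 else ?r i))"
    by (rule det_linear_row_sum) simp
  also have "\<dots> = (\<Sum>j\<in>UNIV. x $ j * det (\<chi> i. if i = 4 then axis j 1 else ?r i))"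
    by (simp add: det_row_mul)
  finally show ?thesis
    unfolding basis_expansion by (simp add: cross4_def inner_vec_def rows mult.commute)
qed

definition nondegenerate_curve :: "real set \<Rightarrow> (real \<Rightarrow> real^4) \<Rightarrow> bool" where
  "nondegenerate_curve I \<gamma> \<longleftrightarrow>
     smooth_on I \<gamma> \<and>
     (\<forall>t\<in>I. deriv_on I \<gamma> t \<noteq> 0) \<and>
     (\<forall>t\<in>I. cross4 (deriv_on I \<gamma> t) ((deriv_on I ^^ 2) \<gamma> t) ((deriv_on I ^^ 3) \<gamma> t) \<noteq> 0)"

definition speed :: "real set \<Rightarrow> (real \<Rightarrow> real^4) \<Rightarrow> real \<Rightarrow> real" where
  "speed I \<gamma> t = norm (deriv_on I \<gamma> t)"

definition frenet_t :: "real set \<Rightarrow> (real \<Rightarrow> real^4) \<Rightarrow> real \<Rightarrow> real^4" where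
  "frenet_t I \<gamma> t = deriv_on I \<gamma> t /\<^sub>R speed I \<gamma> t"

definition frenet_n1 :: "real set \<Rightarrow> (real \<Rightarrow> real^4) \<Rightarrow> real \<Rightarrow> real^4" where
  "frenet_n1 I \<gamma> t =
     deriv_on I (frenet_t I \<gamma>) t /\<^sub>R norm (deriv_on I (frenet_t I \<gamma>) t)"

definition frenet_n3 :: "real set \<Rightarrow> (real \<Rightarrow> real^4) \<Rightarrow> real \<Rightarrow> real^4" where
  "frenet_n3 I \<gamma> t =
     (let w = cross4 (deriv_on I \<gamma> t) ((deriv_on I ^^ 2) \<gamma> t) ((deriv_on I ^^ 3) \<gamma> t)
      in w /\<^sub>R norm w)"

definition frenet_n2 :: "real set \<Rightarrow> (real \<Rightarrow> real^4) \<Rightarrow> real \<Rightarrow> real^4" where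
  "frenet_n2 I \<gamma> t = - cross4 (frenet_n3 I \<gamma> t) (frenet_t I \<gamma> t) (frenet_n1 I \<gamma> t)"

text \<open>
  The curvatures at a parameter are the unique triple of reals that satisfies the Frenet
  equations there.
\<close>

definition frenet_equations ::
  "real set \<Rightarrow> (real \<Rightarrow> real^4) \<Rightarrow> real \<Rightarrow> real \<Rightarrow> real \<Rightarrow> real \<Rightarrow> bool" where
  "frenet_equations I \<gamma> t k1 k2 k3 \<longleftrightarrow>
     k1 > 0 \<and> k2 > 0 \<and>
     deriv_on I (frenet_t I \<gamma>) t = speed I \<gamma> t *\<^sub>R (k1 *\<^sub>R frenet_n1 I \<gamma> t) \<and>
     deriv_on I (frenet_n1 I \<gamma>) t =
       speed I \<gamma> t *\<^sub>R (- k1 *\<^sub>R frenet_t I \<gamma> t + k2 *\<^sub>R frenet_n2 I \<gamma> t) \<and>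
     deriv_on I (frenet_n2 I \<gamma>) t =
       speed I \<gamma> t *\<^sub>R (- k2 *\<^sub>R frenet_n1 I \<gamma> t + k3 *\<^sub>R frenet_n3 I \<gamma> t) \<and>
     deriv_on I (frenet_n3 I \<gamma>) t = - speed I \<gamma> t *\<^sub>R (k3 *\<^sub>R frenet_n2 I \<gamma> t)"

definition curvature1 :: "real set \<Rightarrow> (real \<Rightarrow> real^4) \<Rightarrow> real \<Rightarrow> real" where
  "curvature1 I \<gamma> t = (THE k1. \<exists>k2 k3. frenet_equations I \<gamma> t k1 k2 k3)"

definition curvature2 :: "real set \<Rightarrow> (real \<Rightarrow> real^4) \<Rightarrow> real \<Rightarrow> real" where
  "curvature2 I \<gamma> t = (THE k2. \<exists>k1 k3. frenet_equations I \<gamma> t k1 k2 k3)"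

definition curvature3 :: "real set \<Rightarrow> (real \<Rightarrow> real^4) \<Rightarrow> real \<Rightarrow> real" where
  "curvature3 I \<gamma> t = (THE k3. \<exists>k1 k2. frenet_equations I \<gamma> t k1 k2 k3)"

definition second_mates_with ::
  "real set \<Rightarrow> (real \<Rightarrow> real^4) \<Rightarrow> (real \<Rightarrow> real^4) \<Rightarrow> (real \<Rightarrow> real) \<Rightarrow> bool" where
  "second_mates_with I \<gamma> \<gamma>b l \<longleftrightarrow>
     nondegenerate_curve I \<gamma> \<and> nondegenerate_curve I \<gamma>b \<and>
     (\<exists>t\<in>I. \<gamma> t \<noteq> \<gamma>b t) \<and>
     smooth_on I l \<and>
     (\<forall>t\<in>I. \<gamma>b t = \<gamma> t + l t *\<^sub>R frenet_n1 I \<gamma> t) \<and>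
     (\<forall>t\<in>I. frenet_n1 I \<gamma> t = frenet_n2 I \<gamma>b t \<or> frenet_n1 I \<gamma> t = - frenet_n2 I \<gamma>b t)"

end

theory Submission
  imports Defs
begin

text \<open>
  Write \<open>\<beta> = \<gamma> + l N1\<close> for the shifted curve. Since \<open>\<gamma>\<close> has unit speed, the Frenet equations give
  \<open>\<beta>' = (1 - l \<kappa>1) T + l \<kappa>2 N2\<close>, which is orthogonal to \<open>N1\<close> and never zero.

  For any non-degenerate curve the second normal spans the orthogonal complement of the first
  derivative, the second derivative and the product \<open>w\<close> of the first three
  (\<open>second_normal_iff\<close>). So \<open>N1\<close> agrees up to sign with the second normal of \<open>\<beta>\<close> exactly if
  \<open>\<beta>'' \<bullet> N1 = 0\<close>, \<open>w \<bullet> N1 = 0\<close> and \<open>w \<noteq> 0\<close>, where now \<open>w = \<beta>' \<times> \<beta>'' \<times> \<beta>'''\<close>. These three requirements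
  are the three conditions of the theorem:

  \<^item> \<open>\<beta>'' \<bullet> N1 = \<kappa>1 - l (\<kappa>1\<^sup>2 + \<kappa>2\<^sup>2)\<close>, so the first requirement is the relation
    \<open>l (\<kappa>1\<^sup>2 + \<kappa>2\<^sup>2) = \<kappa>1\<close>.

  \<^item> If this relation holds on the whole interval, it may be differentiated, and the component of
    \<open>\<beta>'''\<close> along \<open>N1\<close> collapses to \<open>- \<kappa>1' / 2\<close>. The component \<open>w \<bullet> N1\<close> is the determinant of the
    remaining coordinates of \<open>\<beta>'\<close>, \<open>\<beta>''\<close>, \<open>\<beta>'''\<close>. The relation in the form
    \<open>\<kappa>1 (1 - l \<kappa>1) = l \<kappa>2\<^sup>2\<close> turns it into \<open>\<kappa>1 (w \<bullet> N1) = l\<^sup>3 \<kappa>2 f2\<close>, so the second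
    requirement is \<open>f2 = 0\<close>.

  \<^item> Up to sign, the other components of \<open>w\<close> are \<open>\<kappa>1' / 2\<close> times the two-by-two minors of \<open>\<beta>'\<close> and \<open>\<beta>''\<close>, whence
    \<open>w \<bullet> w = (w \<bullet> N1)\<^sup>2 + l\<^sup>2 f1 / 4\<close>. Given \<open>f2 = 0\<close>, the third requirement is \<open>f1 > 0\<close>.

  The lemma \<open>W\<beta>\<close> contains the last two computations. The rest of the development supplies what they
  presuppose: smoothness of the frame and of the curvatures, and the Frenet equations.
\<close>


section \<open>Smooth functions on a parameter set\<close>

lemma islimpt_interval:
  fixes I :: "real set"
  assumes "is_interval I" "interior I \<noteq> {}" "t \<in> I"
  shows "t islimpt I"
proof (rule connected_imp_perfect)
  show "connected I" using assms(1) by (simp add: is_interval_connected_1)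
  show "I \<noteq> {x}" for x using assms(2) by auto
qed (rule assms(3))

locale parameter_set =
  fixes I :: "real set"
  assumes perfect: "t \<in> I \<Longrightarrow> t islimpt I"
begin

abbreviation D :: "(real \<Rightarrow> 'a::real_normed_vector) \<Rightarrow> real \<Rightarrow> 'a" where
  "D \<equiv> deriv_on I"

lemma D_eqI: "t \<in> I \<Longrightarrow> (f has_vector_derivative d) (at t within I) \<Longrightarrow> D f t = d"
  unfolding deriv_on_def
  by (rule vector_derivative_within) (use perfect trivial_limit_within in blast)

text \<open>
  Derivatives at a parameter see the values on the parameter set only. All later computations rest on
  this: an identity that holds on the set can be differentiated there.
\<close>

lemma D_cong:
  assumes "\<And>t. t \<in> I \<Longrightarrow> f t = g t" "t \<in> I"
  shows "D f t = D g t"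
proof -
  have "(f has_vector_derivative d) (at t within I) \<longleftrightarrow> (g has_vector_derivative d) (at t within I)" for d
    using assms by (metis has_vector_derivative_transform)
  then show ?thesis by (simp add: deriv_on_def vector_derivative_def)
qed

text \<open>
  Finite differentiability, with one derivative peeled off in each step. For smooth functions a proof
  of closure under an operation has nothing to induct on; here it is an induction on the order, in
  which the derivative of the compound is again built from functions that satisfy the hypotheses of
  the lower order.
\<close>

fun times_diff :: "nat \<Rightarrow> (real \<Rightarrow> 'a::real_normed_vector) \<Rightarrow> bool" where
  "times_diff 0 f \<longleftrightarrow> True"
| "times_diff (Suc n) f \<longleftrightarrow>
     (\<forall>t\<in>I. (f has_vector_derivative D f t) (at t within I)) \<and> times_diff n (D f)"

lemma smooth_on_iff: "smooth_on I f \<longleftrightarrow> (\<forall>n. times_diff n f)"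
proof -
  have "times_diff n f \<longleftrightarrow> (\<forall>k<n. \<forall>t\<in>I. ((D ^^ k) f) differentiable (at t within I))" for n
  proof (induction n arbitrary: f)
    case (Suc n)
    have "(\<forall>k<Suc n. \<forall>t\<in>I. ((D ^^ k) f) differentiable (at t within I)) \<longleftrightarrow>
        (\<forall>t\<in>I. f differentiable (at t within I)) \<and>
        (\<forall>k<n. \<forall>t\<in>I. ((D ^^ k) (D f)) differentiable (at t within I))"
      by (simp add: All_less_Suc2 funpow_Suc_right del: funpow.simps(2))
    moreover have "f differentiable (at t within I) \<longleftrightarrow>
        (f has_vector_derivative D f t) (at t within I)" for t
      by (simp add: deriv_on_def vector_derivative_works)
    ultimately show ?case by (simp add: Suc.IH)
  qed simp
  then show ?thesis unfolding smooth_on_def by blast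
qed

lemma times_diff_cong:
  "(\<And>t. t \<in> I \<Longrightarrow> f t = g t) \<Longrightarrow> times_diff n f \<longleftrightarrow> times_diff n g"
proof (induction n arbitrary: f g)
  case (Suc n)
  have *: "D f t = D g t" if "t \<in> I" for t by (rule D_cong[OF Suc.prems that])
  have "(f has_vector_derivative d) (at t within I) \<longleftrightarrow> (g has_vector_derivative d) (at t within I)"
    if "t \<in> I" for t d
    using Suc.prems that by (metis has_vector_derivative_transform)
  then show ?case using Suc.IH[OF *] * by auto
qed simp

lemma times_diff_SucI:
  assumes "\<And>t. t \<in> I \<Longrightarrow> (f has_vector_derivative g t) (at t within I)" "times_diff n g"
  shows "times_diff (Suc n) f"
proof -
  have *: "D f t = g t" if "t \<in> I" for t using D_eqI assms that by blast
  show ?thesis using assms(1,2) times_diff_cong[of "D f" g n] * by simp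
qed

lemma times_diff_SucD: "times_diff (Suc n) f \<Longrightarrow> times_diff n f"
  by (induction n arbitrary: f) auto

lemma times_diff_add: "times_diff n f \<Longrightarrow> times_diff n g \<Longrightarrow> times_diff n (\<lambda>t. f t + g t)"
proof (induction n arbitrary: f g)
  case (Suc n)
  show ?case
    by (rule times_diff_SucI[where g = "\<lambda>t. D f t + D g t"])
       (use Suc in \<open>auto intro: has_vector_derivative_add\<close>)
qed simp

lemma times_diff_bilinear:
  assumes "bounded_bilinear h"
  shows "times_diff n f \<Longrightarrow> times_diff n g \<Longrightarrow> times_diff n (\<lambda>t. h (f t) (g t))"
proof (induction n arbitrary: f g)
  case (Suc n)
  show ?case
  proof (rule times_diff_SucI[where g = "\<lambda>t. h (f t) (D g t) + h (D f t) (g t)"])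
    show "((\<lambda>t. h (f t) (g t)) has_vector_derivative h (f t) (D g t) + h (D f t) (g t)) (at t within I)"
      if "t \<in> I" for t
      using Suc.prems that bounded_bilinear.has_vector_derivative[OF assms] by auto
    show "times_diff n (\<lambda>t. h (f t) (D g t) + h (D f t) (g t))"
      using Suc.prems Suc.prems[THEN times_diff_SucD] by (intro times_diff_add Suc.IH) auto
  qed
qed simp

lemma times_diff_const: "times_diff n (\<lambda>t. c)"
proof (induction n arbitrary: c)
  case (Suc n)
  show ?case by (rule times_diff_SucI[where g = "\<lambda>t. 0"]) (use Suc in auto)
qed simp

text \<open>
  The exponent is arbitrary in the induction because differentiating lowers it. The instances
  \<open>1/2\<close> and \<open>-1\<close> give norms and reciprocals.
\<close>

lemma times_diff_powr:
  fixes f :: "real \<Rightarrow> real"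
  assumes pos: "\<And>t. t \<in> I \<Longrightarrow> f t > 0"
  shows "times_diff n f \<Longrightarrow> times_diff n (\<lambda>t. f t powr a)"
proof (induction n arbitrary: a)
  case (Suc n)
  show ?case
  proof (rule times_diff_SucI[where g = "\<lambda>t. D f t * (a * f t powr (a - 1))"])
    fix t assume "t \<in> I"
    then have "(f has_field_derivative D f t) (at t within I)"
      using Suc.prems by (simp add: has_real_derivative_iff_has_vector_derivative)
    then have "((\<lambda>t. f t powr a) has_field_derivative a * f t powr (a - 1) * D f t) (at t within I)"
      using pos[OF \<open>t \<in> I\<close>] by (auto intro!: derivative_eq_intros)
    then show "((\<lambda>t. f t powr a) has_vector_derivative D f t * (a * f t powr (a - 1))) (at t within I)"
      by (simp add: has_real_derivative_iff_has_vector_derivative mult_ac)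
  next
    show "times_diff n (\<lambda>t. D f t * (a * f t powr (a - 1)))"
      using Suc.prems Suc.IH[OF times_diff_SucD[OF Suc.prems]]
      by (intro times_diff_bilinear[OF bounded_bilinear_mult] times_diff_const) auto
  qed
qed simp

lemma smooth_deriv: "smooth_on I f \<Longrightarrow> t \<in> I \<Longrightarrow> (f has_vector_derivative D f t) (at t within I)"
  unfolding smooth_on_iff by (metis times_diff.simps(2))

lemma smooth_D: "smooth_on I f \<Longrightarrow> smooth_on I (D f)"
  unfolding smooth_on_iff by (metis times_diff.simps(2))

lemma smooth_cong: "(\<And>t. t \<in> I \<Longrightarrow> f t = g t) \<Longrightarrow> smooth_on I f \<longleftrightarrow> smooth_on I g"
  unfolding smooth_on_iff using times_diff_cong[of f g] by blast

lemma smooth_const: "smooth_on I (\<lambda>t. c)"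
  by (simp add: smooth_on_iff times_diff_const)

lemma smooth_add: "smooth_on I f \<Longrightarrow> smooth_on I g \<Longrightarrow> smooth_on I (\<lambda>t. f t + g t)"
  by (simp add: smooth_on_iff times_diff_add)

lemma smooth_bilinear:
  "bounded_bilinear h \<Longrightarrow> smooth_on I f \<Longrightarrow> smooth_on I g \<Longrightarrow> smooth_on I (\<lambda>t. h (f t) (g t))"
  by (simp add: smooth_on_iff times_diff_bilinear)

lemmas smooth_mult = smooth_bilinear[OF bounded_bilinear_mult]
  and smooth_scaleR = smooth_bilinear[OF bounded_bilinear_scaleR]
  and smooth_inner = smooth_bilinear[OF bounded_bilinear_inner]

lemma smooth_powr:
  fixes f :: "real \<Rightarrow> real"
  shows "(\<And>t. t \<in> I \<Longrightarrow> f t > 0) \<Longrightarrow> smooth_on I f \<Longrightarrow> smooth_on I (\<lambda>t. f t powr a)"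
  by (simp add: smooth_on_iff times_diff_powr)

lemma smooth_uminus: "smooth_on I f \<Longrightarrow> smooth_on I (\<lambda>t. - f t)"
  using smooth_scaleR[OF smooth_const[of "-1"], of f] by simp

lemma smooth_diff: "smooth_on I f \<Longrightarrow> smooth_on I g \<Longrightarrow> smooth_on I (\<lambda>t. f t - g t)"
  using smooth_add[OF _ smooth_uminus, of f g] by simp

lemma smooth_norm:
  fixes f :: "real \<Rightarrow> 'a::real_inner"
  assumes "smooth_on I f" "\<And>t. t \<in> I \<Longrightarrow> f t \<noteq> 0"
  shows "smooth_on I (\<lambda>t. norm (f t))"
proof -
  have "smooth_on I (\<lambda>t. (f t \<bullet> f t) powr (1/2))"
    by (intro smooth_powr smooth_inner assms(1)) (use assms(2) in auto)
  then show ?thesis by (simp add: norm_eq_sqrt_inner powr_half_sqrt)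
qed

lemma smooth_normalize:
  fixes f :: "real \<Rightarrow> 'a::real_inner"
  assumes "smooth_on I f" "\<And>t. t \<in> I \<Longrightarrow> f t \<noteq> 0"
  shows "smooth_on I (\<lambda>t. f t /\<^sub>R norm (f t))"
proof -
  have "smooth_on I (\<lambda>t. norm (f t) powr (-1))"
    by (intro smooth_powr smooth_norm assms) (use assms(2) in auto)
  then have "smooth_on I (\<lambda>t. inverse (norm (f t)))"
    by (simp add: powr_minus)
  then show ?thesis by (rule smooth_scaleR) (rule assms(1))
qed

lemma smooth_component:
  fixes f :: "real \<Rightarrow> real^'n"
  shows "smooth_on I f \<Longrightarrow> smooth_on I (\<lambda>t. f t $ i)"
  using smooth_inner[OF _ smooth_const[of "axis i 1"], of f] by (simp add: inner_axis)

end

section \<open>Determinants and the vector product in four dimensions\<close>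

lemma det_4:
  "det (A::'a::comm_ring_1^4^4) =
    A$1$1 * A$2$2 * A$3$3 * A$4$4 - A$1$1 * A$2$2 * A$3$4 * A$4$3
  - A$1$1 * A$2$3 * A$3$2 * A$4$4 + A$1$1 * A$2$3 * A$3$4 * A$4$2
  + A$1$1 * A$2$4 * A$3$2 * A$4$3 - A$1$1 * A$2$4 * A$3$3 * A$4$2
  - A$1$2 * A$2$1 * A$3$3 * A$4$4 + A$1$2 * A$2$1 * A$3$4 * A$4$3
  + A$1$2 * A$2$3 * A$3$1 * A$4$4 - A$1$2 * A$2$3 * A$3$4 * A$4$1
  - A$1$2 * A$2$4 * A$3$1 * A$4$3 + A$1$2 * A$2$4 * A$3$3 * A$4$1
  + A$1$3 * A$2$1 * A$3$2 * A$4$4 - A$1$3 * A$2$1 * A$3$4 * A$4$2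
  - A$1$3 * A$2$2 * A$3$1 * A$4$4 + A$1$3 * A$2$2 * A$3$4 * A$4$1
  + A$1$3 * A$2$4 * A$3$1 * A$4$2 - A$1$3 * A$2$4 * A$3$2 * A$4$1
  - A$1$4 * A$2$1 * A$3$2 * A$4$3 + A$1$4 * A$2$1 * A$3$3 * A$4$2
  + A$1$4 * A$2$2 * A$3$1 * A$4$3 - A$1$4 * A$2$2 * A$3$3 * A$4$1
  - A$1$4 * A$2$3 * A$3$1 * A$4$2 + A$1$4 * A$2$3 * A$3$2 * A$4$1"
proof -
  have f1: "finite {2::4, 3, 4}" "1 \<notin> {2::4, 3, 4}"
    and f2: "finite {3::4, 4}" "2 \<notin> {3::4, 4}"
    and f3: "finite {4::4}" "3 \<notin> {4::4}"
    by auto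
  show ?thesis
    unfolding det_def UNIV_4
    unfolding sum_over_permutations_insert[OF f1]
    unfolding sum_over_permutations_insert[OF f2]
    unfolding sum_over_permutations_insert[OF f3]
    unfolding permutes_sing
    by (simp add: sign_swap_id permutation_swap_id permutation_compose sign_compose sign_id swap_id_eq)
qed

lemma cross4_component:
  "cross4 a b c $ i = det (vector [a, b, c, axis i 1] :: real^4^4)"
  by (simp add: cross4_def)

lemma cross4_orthogonal:
  "cross4 a b c \<bullet> a = 0" "cross4 a b c \<bullet> b = 0" "cross4 a b c \<bullet> c = 0"
  by (simp_all add: cross4_inner det_4 vector_4_rows)

text \<open>
  Alternation kills every contribution of an earlier vector to a later argument, so only the diagonal
  coefficients survive. This lets one replace the derivatives of a curve by the derivatives of its
  tangent, and then of its first normal.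
\<close>

lemma cross4_triangular:
  "cross4 (p *\<^sub>R a) (q *\<^sub>R a + r *\<^sub>R b) (x *\<^sub>R a + y *\<^sub>R b + z *\<^sub>R c) = (p * r * z) *\<^sub>R cross4 a b c"
proof (rule vector_eq_rdot[THEN iffD1], rule allI)
  \<comment> \<open>Pairing with an arbitrary vector reduces the claim to a polynomial identity in coordinates.\<close>
  fix d :: "real^4"
  define a1 a2 a3 a4 where a: "a1 = a $ 1" "a2 = a $ 2" "a3 = a $ 3" "a4 = a $ 4"
  define b1 b2 b3 b4 where b: "b1 = b $ 1" "b2 = b $ 2" "b3 = b $ 3" "b4 = b $ 4"
  define c1 c2 c3 c4 where c: "c1 = c $ 1" "c2 = c $ 2" "c3 = c $ 3" "c4 = c $ 4"
  define d1 d2 d3 d4 where d: "d1 = d $ 1" "d2 = d $ 2" "d3 = d $ 3" "d4 = d $ 4"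
  show "cross4 (p *\<^sub>R a) (q *\<^sub>R a + r *\<^sub>R b) (x *\<^sub>R a + y *\<^sub>R b + z *\<^sub>R c) \<bullet> d =
      ((p * r * z) *\<^sub>R cross4 a b c) \<bullet> d"
    by (simp add: cross4_inner det_4 vector_4_rows
        a[symmetric] b[symmetric] c[symmetric] d[symmetric]) algebra
qed

text \<open>
  The right-hand side is the Gram determinant of the three vectors.
\<close>

lemma norm_cross4:
  "cross4 a b c \<bullet> cross4 a b c =
     (a \<bullet> a) * ((b \<bullet> b) * (c \<bullet> c) - (b \<bullet> c)\<^sup>2)
   - (a \<bullet> b) * ((a \<bullet> b) * (c \<bullet> c) - (b \<bullet> c) * (a \<bullet> c))
   + (a \<bullet> c) * ((a \<bullet> b) * (b \<bullet> c) - (b \<bullet> b) * (a \<bullet> c))"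
proof -
  \<comment> \<open>In coordinates, this is an identity of polynomials in twelve variables.\<close>
  define a1 a2 a3 a4 where a: "a1 = a $ 1" "a2 = a $ 2" "a3 = a $ 3" "a4 = a $ 4"
  define b1 b2 b3 b4 where b: "b1 = b $ 1" "b2 = b $ 2" "b3 = b $ 3" "b4 = b $ 4"
  define c1 c2 c3 c4 where c: "c1 = c $ 1" "c2 = c $ 2" "c3 = c $ 3" "c4 = c $ 4"
  show ?thesis
    by (simp add: inner_vec_def sum_4 cross4_def det_4 vector_4_rows axis_def
        a[symmetric] b[symmetric] c[symmetric]) algebra
qed

definition positive_frame :: "real^4 \<Rightarrow> real^4 \<Rightarrow> real^4 \<Rightarrow> real^4 \<Rightarrow> bool" where
  "positive_frame a b c d \<longleftrightarrow>
     a \<bullet> a = 1 \<and> b \<bullet> b = 1 \<and> c \<bullet> c = 1 \<and> d \<bullet> d = 1 \<and>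
     a \<bullet> b = 0 \<and> a \<bullet> c = 0 \<and> a \<bullet> d = 0 \<and> b \<bullet> c = 0 \<and> b \<bullet> d = 0 \<and> c \<bullet> d = 0 \<and>
     det (vector [a, b, c, d] :: real^4^4) = 1"

text \<open>
  The sign in the second normal makes the frame positively oriented: moving the last of four rows to
  the front is an odd permutation.
\<close>

lemma positive_frame_cross4:
  assumes "a \<bullet> a = 1" "b \<bullet> b = 1" "d \<bullet> d = 1" "a \<bullet> b = 0" "a \<bullet> d = 0" "b \<bullet> d = 0"
  shows "positive_frame a b (- cross4 d a b) d"
proof -
  let ?c = "- cross4 d a b"
  have orth: "a \<bullet> ?c = 0" "b \<bullet> ?c = 0" "?c \<bullet> d = 0"
    by (simp_all add: cross4_orthogonal inner_commute[of _ "cross4 d a b"])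
  have unit: "?c \<bullet> ?c = 1"
    using assms by (simp add: norm_cross4 inner_commute[of d a] inner_commute[of d b])
  have "det (vector [a, b, ?c, d] :: real^4^4) = - det (vector [d, a, b, ?c])"
    by (simp add: det_4 vector_4_rows algebra_simps)
  also have "\<dots> = ?c \<bullet> ?c" by (simp add: cross4_inner[symmetric])
  finally show ?thesis
    using orth unit assms by (simp add: positive_frame_def)
qed

lemma positive_frame_expand:
  assumes "positive_frame a b c d"
  shows "x = (x \<bullet> a) *\<^sub>R a + (x \<bullet> b) *\<^sub>R b + (x \<bullet> c) *\<^sub>R c + (x \<bullet> d) *\<^sub>R d"
proof -
  let ?E = "vector [a, b, c, d] :: real^4^4"
  have "row i ?E = ?E $ i" for i by (simp add: row_def)
  then have "orthogonal_matrix ?E"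
    using assms unfolding orthogonal_matrix_orthonormal_rows
    by (simp add: forall_4 vector_4_rows positive_frame_def norm_eq_1 orthogonal_def inner_commute)
  then have "transpose ?E ** ?E = mat 1" by (simp add: orthogonal_matrix)
  then have "x = transpose ?E *v (?E *v x)" by (simp add: matrix_vector_mul_assoc)
  also have "\<dots> = (x \<bullet> a) *\<^sub>R a + (x \<bullet> b) *\<^sub>R b + (x \<bullet> c) *\<^sub>R c + (x \<bullet> d) *\<^sub>R d"
    by (simp add: vec_eq_iff matrix_vector_mult_def sum_4 transpose_def vector_4_rows inner_vec_def
       algebra_simps)
  finally show ?thesis .
qed

text \<open>
  A determinant may be computed from the coordinates with respect to any positively oriented
  orthonormal frame: the passage to coordinates is multiplication by the transpose of the frame, whose
  determinant is 1.
\<close>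

lemma det_positive_frame:
  assumes "positive_frame a b c d"
  shows "det (X :: real^4^4) = det (\<chi> i. vector [X $ i \<bullet> a, X $ i \<bullet> b, X $ i \<bullet> c, X $ i \<bullet> d] :: real^4^4)"
proof -
  let ?E = "vector [a, b, c, d] :: real^4^4"
  have "X ** transpose ?E = (\<chi> i. vector [X $ i \<bullet> a, X $ i \<bullet> b, X $ i \<bullet> c, X $ i \<bullet> d])"
    by (simp add: vec_eq_iff matrix_matrix_mult_def transpose_def inner_vec_def forall_4 vector_4_rows)
  then show ?thesis
    using assms det_mul[of X "transpose ?E"] by (simp add: positive_frame_def det_transpose)
qed

lemma (in parameter_set) smooth_det4:
  fixes a b c d :: "real \<Rightarrow> real^4"
  assumes "smooth_on I a" "smooth_on I b" "smooth_on I c" "smooth_on I d"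
  shows "smooth_on I (\<lambda>t. det (vector [a t, b t, c t, d t] :: real^4^4))"
  unfolding det_4 vector_4_rows
  by (intro smooth_add smooth_diff smooth_mult smooth_component assms)

lemma (in parameter_set) smooth_cross4:
  assumes "smooth_on I a" "smooth_on I b" "smooth_on I c"
  shows "smooth_on I (\<lambda>t. cross4 (a t) (b t) (c t))"
proof -
  have "smooth_on I (\<lambda>t. \<Sum>i\<in>UNIV. (cross4 (a t) (b t) (c t) $ i) *\<^sub>R (axis i 1 :: real^4))"
    unfolding cross4_component sum_4
    by (intro smooth_add smooth_scaleR smooth_const smooth_det4 assms)
  then show ?thesis
    using basis_expansion[where 'a=real and 'n=4] by (simp add: scalar_mult_eq_scaleR)
qed

section \<open>Product rules for smooth functions\<close>

lemma normalized_unit: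
  fixes x :: "'a::real_inner"
  shows "x \<noteq> 0 \<Longrightarrow> (x /\<^sub>R norm x) \<bullet> (x /\<^sub>R norm x) = 1"
  by (simp add: dot_square_norm power2_eq_square)

context parameter_set
begin

lemma D_inner_const:
  fixes f g :: "real \<Rightarrow> 'a::real_inner"
  assumes "smooth_on I f" "smooth_on I g" "\<And>t. t \<in> I \<Longrightarrow> f t \<bullet> g t = c" "t \<in> I"
  shows "D f t \<bullet> g t + f t \<bullet> D g t = 0"
proof -
  have "((\<lambda>t. f t \<bullet> g t) has_vector_derivative f t \<bullet> D g t + D f t \<bullet> g t) (at t within I)"
    using assms smooth_deriv
    by (intro bounded_bilinear.has_vector_derivative[OF bounded_bilinear_inner]) auto
  then have "D (\<lambda>t. f t \<bullet> g t) t = f t \<bullet> D g t + D f t \<bullet> g t"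
    using D_eqI assms(4) by blast
  moreover have "D (\<lambda>t. f t \<bullet> g t) t = D (\<lambda>t. c) t"
    by (rule D_cong) (use assms in auto)
  moreover have "D (\<lambda>t. c) t = 0"
    by (rule D_eqI) (use assms in auto)
  ultimately show ?thesis by simp
qed

lemma D_scaleR:
  assumes "smooth_on I f" "smooth_on I g" "\<And>t. t \<in> I \<Longrightarrow> h t = f t *\<^sub>R g t" "t \<in> I"
  shows "D h t = D f t *\<^sub>R g t + f t *\<^sub>R D g t"
proof -
  have "D h t = D (\<lambda>t. f t *\<^sub>R g t) t" by (intro D_cong assms)
  also have "\<dots> = f t *\<^sub>R D g t + D f t *\<^sub>R g t"
    by (rule D_eqI bounded_bilinear.has_vector_derivative[OF bounded_bilinear_scaleR] smooth_deriv assms)+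
  finally show ?thesis by simp
qed

lemma D_add:
  assumes "smooth_on I f" "smooth_on I g" "\<And>t. t \<in> I \<Longrightarrow> h t = f t + g t" "t \<in> I"
  shows "D h t = D f t + D g t"
proof -
  have "D h t = D (\<lambda>t. f t + g t) t" by (intro D_cong assms)
  also have "\<dots> = D f t + D g t"
    by (rule D_eqI has_vector_derivative_add smooth_deriv assms)+
  finally show ?thesis .
qed

end

section \<open>Frenet frame and curvatures\<close>

locale frenet_curve = parameter_set I for I +
  fixes \<gamma> :: "real \<Rightarrow> real^4"
  assumes nondegenerate: "nondegenerate_curve I \<gamma>"
begin

abbreviation "T \<equiv> frenet_t I \<gamma>"
abbreviation "N1 \<equiv> frenet_n1 I \<gamma>"
abbreviation "N2 \<equiv> frenet_n2 I \<gamma>"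
abbreviation "N3 \<equiv> frenet_n3 I \<gamma>"
abbreviation "v \<equiv> speed I \<gamma>"

text \<open>
  These three functions are the curvatures multiplied by the speed, as they appear in the Frenet
  equations for a general parameter.
\<close>

definition "m t = norm (D T t)"
definition "p t = D N1 t \<bullet> N2 t"
definition "q t = D N2 t \<bullet> N3 t"
abbreviation "W \<equiv> \<lambda>t. cross4 (D \<gamma> t) (D (D \<gamma>) t) (D (D (D \<gamma>)) t)"

lemma smooth_gamma: "smooth_on I \<gamma>"
  and regular: "t \<in> I \<Longrightarrow> D \<gamma> t \<noteq> 0"
  and W_nonzero: "t \<in> I \<Longrightarrow> W t \<noteq> 0"
  using nondegenerate by (auto simp: nondegenerate_curve_def eval_nat_numeral)

lemma N3_eq: "N3 t = W t /\<^sub>R norm (W t)"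
  by (simp add: frenet_n3_def eval_nat_numeral Let_def)

lemma smooth_v: "smooth_on I v"
  unfolding speed_def by (intro smooth_norm smooth_D smooth_gamma regular)

lemma v_pos: "t \<in> I \<Longrightarrow> v t > 0"
  using regular by (simp add: speed_def)

lemma smooth_T: "smooth_on I T"
  unfolding frenet_t_def speed_def by (intro smooth_normalize smooth_D smooth_gamma regular)

lemma D_gamma: "t \<in> I \<Longrightarrow> D \<gamma> t = v t *\<^sub>R T t"
  using v_pos[of t] by (simp add: frenet_t_def)

lemma D2_gamma: "t \<in> I \<Longrightarrow> D (D \<gamma>) t = D v t *\<^sub>R T t + v t *\<^sub>R D T t"
  by (rule D_scaleR[OF smooth_v smooth_T D_gamma])

lemma D3_gamma:
  assumes t: "t \<in> I"
  shows "D (D (D \<gamma>)) t = D (D v) t *\<^sub>R T t + (2 * D v t) *\<^sub>R D T t + v t *\<^sub>R D (D T) t"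
proof -
  have "D (D (D \<gamma>)) t = D (\<lambda>t. D v t *\<^sub>R T t) t + D (\<lambda>t. v t *\<^sub>R D T t) t"
    by (intro D_add D2_gamma smooth_scaleR smooth_D smooth_v smooth_T t)
  also have "D (\<lambda>t. D v t *\<^sub>R T t) t = D (D v) t *\<^sub>R T t + D v t *\<^sub>R D T t"
    by (intro D_scaleR t smooth_D smooth_v smooth_T refl)
  also have "D (\<lambda>t. v t *\<^sub>R D T t) t = D v t *\<^sub>R D T t + v t *\<^sub>R D (D T) t"
    by (intro D_scaleR t smooth_D smooth_v smooth_T refl)
  finally show ?thesis by (simp only: mult_2 scaleR_left_distrib add.assoc)
qed

text \<open>
  Non-degeneracy thus forces the derivative of the tangent not to vanish; the first normal is well
  defined and smooth for this reason.
\<close>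

lemma W_eq_T: "t \<in> I \<Longrightarrow> W t = (v t)^3 *\<^sub>R cross4 (T t) (D T t) (D (D T) t)"
  by (simp add: D3_gamma D2_gamma D_gamma cross4_triangular power3_eq_cube)

lemma DT_nonzero:
  assumes "t \<in> I" shows "D T t \<noteq> 0"
proof
  assume "D T t = 0"
  then have "cross4 (T t) (D T t) (D (D T) t) = 0"
    using cross4_triangular[of 1 "T t" 0 0 "T t" 0 0 1 "D (D T) t"] by simp
  then show False using W_nonzero W_eq_T assms by simp
qed

lemma smooth_m: "smooth_on I m"
  unfolding m_def by (intro smooth_norm smooth_D smooth_T DT_nonzero)

lemma m_pos: "t \<in> I \<Longrightarrow> m t > 0"
  using DT_nonzero by (simp add: m_def)

lemma smooth_N1: "smooth_on I N1"
  unfolding frenet_n1_def by (intro smooth_normalize smooth_D smooth_T DT_nonzero)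

lemma D_T: "t \<in> I \<Longrightarrow> D T t = m t *\<^sub>R N1 t"
  using m_pos[of t] by (simp add: frenet_n1_def m_def)

lemma D2_T: "t \<in> I \<Longrightarrow> D (D T) t = D m t *\<^sub>R N1 t + m t *\<^sub>R D N1 t"
  by (rule D_scaleR[OF smooth_m smooth_N1 D_T])

text \<open>
  In this form the product is visibly orthogonal to the derivative of the first normal, which accounts
  for the missing third normal in the second Frenet equation.
\<close>

lemma W_eq_N1: "t \<in> I \<Longrightarrow> W t = ((v t)^3 * (m t)^2) *\<^sub>R cross4 (T t) (N1 t) (D N1 t)"
  using cross4_triangular[of 1 "T t" 0 "m t" "N1 t" 0 "D m t" "m t" "D N1 t"]
  by (simp add: W_eq_T D2_T D_T power2_eq_square)

lemma smooth_N3: "smooth_on I N3"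
proof -
  have "smooth_on I (\<lambda>t. W t /\<^sub>R norm (W t))"
    by (intro smooth_normalize smooth_cross4 smooth_D smooth_gamma W_nonzero)
  then show ?thesis by (simp add: N3_eq[abs_def])
qed

lemma smooth_N2: "smooth_on I N2"
  unfolding frenet_n2_def
  by (intro smooth_uminus smooth_cross4 smooth_N3 smooth_T smooth_N1)

lemma T_unit: "t \<in> I \<Longrightarrow> T t \<bullet> T t = 1"
  unfolding frenet_t_def speed_def by (intro normalized_unit regular)

lemma N1_unit: "t \<in> I \<Longrightarrow> N1 t \<bullet> N1 t = 1"
  unfolding frenet_n1_def by (intro normalized_unit DT_nonzero)

lemma N3_unit: "t \<in> I \<Longrightarrow> N3 t \<bullet> N3 t = 1"
  unfolding N3_eq by (intro normalized_unit W_nonzero)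

lemma T_N1: "t \<in> I \<Longrightarrow> T t \<bullet> N1 t = 0"
  using D_inner_const[OF smooth_T smooth_T T_unit, of t] m_pos[of t]
  by (simp add: D_T inner_commute)

lemma N3_orthogonal:
  assumes "t \<in> I"
  shows "T t \<bullet> N3 t = 0" "N1 t \<bullet> N3 t = 0" "D N1 t \<bullet> N3 t = 0"
  using assms
  by (simp_all add: N3_eq W_eq_N1 cross4_orthogonal inner_commute[of _ "cross4 _ _ _"])

lemma frame: "t \<in> I \<Longrightarrow> positive_frame (T t) (N1 t) (N2 t) (N3 t)"
  unfolding frenet_n2_def
  by (intro positive_frame_cross4 T_unit N1_unit N3_unit T_N1 N3_orthogonal)

lemma frame_inner [simp]:
  assumes "t \<in> I"
  shows "T t \<bullet> T t = 1" "N1 t \<bullet> N1 t = 1" "N2 t \<bullet> N2 t = 1" "N3 t \<bullet> N3 t = 1"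
    "T t \<bullet> N1 t = 0" "T t \<bullet> N2 t = 0" "T t \<bullet> N3 t = 0"
    "N1 t \<bullet> T t = 0" "N1 t \<bullet> N2 t = 0" "N1 t \<bullet> N3 t = 0"
    "N2 t \<bullet> T t = 0" "N2 t \<bullet> N1 t = 0" "N2 t \<bullet> N3 t = 0"
    "N3 t \<bullet> T t = 0" "N3 t \<bullet> N1 t = 0" "N3 t \<bullet> N2 t = 0"
  using frame[OF assms] by (simp_all add: positive_frame_def inner_commute)

lemma D_N1:
  assumes "t \<in> I"
  shows "D N1 t = - m t *\<^sub>R T t + p t *\<^sub>R N2 t"
proof -
  have "D N1 t \<bullet> T t = - m t"
    using D_inner_const[OF smooth_N1 smooth_T _ assms, of 0] assms by (simp add: D_T)
  moreover have "D N1 t \<bullet> N1 t = 0"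
    using D_inner_const[OF smooth_N1 smooth_N1 _ assms, of 1] assms by (simp add: inner_commute)
  ultimately show ?thesis
    using positive_frame_expand[OF frame[OF assms], of "D N1 t"] p_def[of t] N3_orthogonal(3)[OF assms] by simp
qed

lemma D_N2:
  assumes "t \<in> I"
  shows "D N2 t = - p t *\<^sub>R N1 t + q t *\<^sub>R N3 t"
proof -
  have "D N2 t \<bullet> T t = 0"
    using D_inner_const[OF smooth_N2 smooth_T _ assms, of 0] assms by (simp add: D_T)
  moreover have "D N2 t \<bullet> N1 t = - p t"
    using D_inner_const[OF smooth_N2 smooth_N1 _ assms, of 0] assms by (simp add: inner_commute p_def)
  moreover have "D N2 t \<bullet> N2 t = 0"
    using D_inner_const[OF smooth_N2 smooth_N2 _ assms, of 1] assms by (simp add: inner_commute)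
  ultimately show ?thesis
    using positive_frame_expand[OF frame[OF assms], of "D N2 t"] q_def[of t] by simp
qed

lemma D_N3:
  assumes "t \<in> I"
  shows "D N3 t = - q t *\<^sub>R N2 t"
proof -
  have "D N3 t \<bullet> T t = 0"
    using D_inner_const[OF smooth_N3 smooth_T _ assms, of 0] assms by (simp add: D_T)
  moreover have "D N3 t \<bullet> N1 t = 0"
    using D_inner_const[OF smooth_N3 smooth_N1 _ assms, of 0] assms N3_orthogonal(3)
    by (simp add: inner_commute)
  moreover have "D N3 t \<bullet> N2 t = - q t"
    using D_inner_const[OF smooth_N3 smooth_N2 _ assms, of 0] assms by (simp add: inner_commute q_def)
  moreover have "D N3 t \<bullet> N3 t = 0"
    using D_inner_const[OF smooth_N3 smooth_N3 _ assms, of 1] assms by (simp add: inner_commute)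
  ultimately show ?thesis
    using positive_frame_expand[OF frame[OF assms], of "D N3 t"] by simp
qed

text \<open>
  The product of the first three derivatives has a positive component along the third normal. As a
  determinant in the Frenet frame, this component is a positive multiple of \<open>p\<close>.
\<close>

lemma p_pos:
  assumes t: "t \<in> I"
  shows "p t > 0"
proof -
  have "0 < norm (W t)" using W_nonzero t by simp
  also have "norm (W t) = W t \<bullet> N3 t"
    using W_nonzero[OF t] by (simp add: N3_eq dot_square_norm power2_eq_square)
  also have "\<dots> = (v t)^3 * (m t)^2 * det (vector [T t, N1 t, D N1 t, N3 t] :: real^4^4)"
    using t by (simp add: W_eq_N1 cross4_inner)
  also have "det (vector [T t, N1 t, D N1 t, N3 t] :: real^4^4) = p t"
    using t N3_orthogonal(3)[OF t]
    by (subst det_positive_frame[OF frame[OF t]]) (simp add: p_def det_4 vector_4_rows)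
  finally show ?thesis
    by (rule zero_less_mult_pos) (use v_pos[OF t] m_pos[OF t] in simp)
qed

text \<open>
  Existence and uniqueness of the curvatures: each of them can be read off by pairing one Frenet
  equation with one frame vector.
\<close>

lemma frenet_equations_iff:
  assumes t: "t \<in> I"
  shows "frenet_equations I \<gamma> t c1 c2 c3 \<longleftrightarrow>
    c1 = m t / v t \<and> c2 = p t / v t \<and> c3 = q t / v t"
proof
  note v = v_pos[OF t]
  assume "frenet_equations I \<gamma> t c1 c2 c3"
  then have T: "D T t = v t *\<^sub>R (c1 *\<^sub>R N1 t)"
    and N1: "D N1 t = v t *\<^sub>R (- c1 *\<^sub>R T t + c2 *\<^sub>R N2 t)"
    and N2: "D N2 t = v t *\<^sub>R (- c2 *\<^sub>R N1 t + c3 *\<^sub>R N3 t)"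
    by (auto simp: frenet_equations_def)
  have "m t = v t * c1"
    using arg_cong[OF T, of "\<lambda>x. x \<bullet> N1 t"] t D_T[OF t] by simp
  moreover have "p t = v t * c2"
    using arg_cong[OF N1, of "\<lambda>x. x \<bullet> N2 t"] t by (simp add: p_def inner_diff_left inner_add_left)
  moreover have "q t = v t * c3"
    using arg_cong[OF N2, of "\<lambda>x. x \<bullet> N3 t"] t by (simp add: q_def inner_diff_left inner_add_left)
  ultimately show "c1 = m t / v t \<and> c2 = p t / v t \<and> c3 = q t / v t"
    using v by simp
next
  assume "c1 = m t / v t \<and> c2 = p t / v t \<and> c3 = q t / v t"
  then show "frenet_equations I \<gamma> t c1 c2 c3"
    using D_T[OF t] D_N1[OF t] D_N2[OF t] D_N3[OF t] m_pos[OF t] p_pos[OF t] v_pos[OF t]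
    by (simp add: frenet_equations_def scaleR_add_right scaleR_diff_right)
qed

lemma curvature_eq:
  assumes "t \<in> I"
  shows "curvature1 I \<gamma> t = m t / v t"
    "curvature2 I \<gamma> t = p t / v t"
    "curvature3 I \<gamma> t = q t / v t"
  using assms
  by (simp_all add: curvature1_def curvature2_def curvature3_def frenet_equations_iff)

lemma frenet:
  "t \<in> I \<Longrightarrow> frenet_equations I \<gamma> t (curvature1 I \<gamma> t) (curvature2 I \<gamma> t) (curvature3 I \<gamma> t)"
  by (simp add: frenet_equations_iff curvature_eq)

lemma smooth_curvature:
  "smooth_on I (curvature1 I \<gamma>)" "smooth_on I (curvature2 I \<gamma>)" "smooth_on I (curvature3 I \<gamma>)"
proof -
  have *: "smooth_on I (\<lambda>t. x t / v t)" if "smooth_on I x" for x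
  proof -
    have "smooth_on I (\<lambda>t. x t * v t powr (-1))"
      by (intro smooth_mult smooth_powr smooth_v v_pos that)
    then show ?thesis
      by (rule smooth_cong[THEN iffD1, rotated]) (simp add: v_pos less_imp_le powr_minus field_simps)
  qed
  have "smooth_on I (\<lambda>t. m t / v t)"
    "smooth_on I (\<lambda>t. p t / v t)" "smooth_on I (\<lambda>t. q t / v t)"
    unfolding p_def q_def
    by (intro * smooth_m smooth_inner smooth_D smooth_N1 smooth_N2 smooth_N3)+
  then show "smooth_on I (curvature1 I \<gamma>)" "smooth_on I (curvature2 I \<gamma>)" "smooth_on I (curvature3 I \<gamma>)"
    by (auto intro: smooth_cong[THEN iffD1, rotated] simp: curvature_eq)
qed

text \<open>
  The first two derivatives span the same plane as \<open>T\<close> and \<open>N1\<close>, and \<open>W\<close> is a multiple of \<open>N3\<close>. The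
  remaining direction in four-space is that of \<open>N2\<close>.
\<close>

lemma second_normal_iff:
  assumes t: "t \<in> I" and u: "u \<bullet> u = 1"
  shows "(u = N2 t \<or> u = - N2 t) \<longleftrightarrow> D \<gamma> t \<bullet> u = 0 \<and> D (D \<gamma>) t \<bullet> u = 0 \<and> W t \<bullet> u = 0"
proof -
  have pos: "v t > 0" "m t > 0" "norm (W t) > 0"
    using v_pos m_pos W_nonzero t by auto
  then have W: "W t = norm (W t) *\<^sub>R N3 t" by (simp add: N3_eq)
  have "(D \<gamma> t \<bullet> u = 0 \<and> D (D \<gamma>) t \<bullet> u = 0 \<and> W t \<bullet> u = 0) \<longleftrightarrow>
      (u \<bullet> T t = 0 \<and> u \<bullet> N1 t = 0 \<and> u \<bullet> N3 t = 0)"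
    using pos by (subst W) (auto simp: D_gamma D2_gamma D_T t inner_add_left inner_commute[of u])
  also have "\<dots> \<longleftrightarrow> u = N2 t \<or> u = - N2 t"
  proof
    assume "u \<bullet> T t = 0 \<and> u \<bullet> N1 t = 0 \<and> u \<bullet> N3 t = 0"
    then have e: "u = (u \<bullet> N2 t) *\<^sub>R N2 t"
      using positive_frame_expand[OF frame[OF t], of u] by simp
    have "(u \<bullet> N2 t)^2 = 1"
      using arg_cong[OF e, of "\<lambda>x. x \<bullet> u"] u by (simp add: power2_eq_square inner_commute)
    then have "u \<bullet> N2 t = 1 \<or> u \<bullet> N2 t = -1" by (simp add: power2_eq_1_iff)
    then show "u = N2 t \<or> u = - N2 t" using e by auto
  qed (use t in auto)
  finally show ?thesis by blast
qed

end

locale unit_speed_curve = frenet_curve +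
  assumes unit_speed: "t \<in> I \<Longrightarrow> v t = 1"
begin

abbreviation "\<kappa>1 \<equiv> curvature1 I \<gamma>"
abbreviation "\<kappa>2 \<equiv> curvature2 I \<gamma>"
abbreviation "\<kappa>3 \<equiv> curvature3 I \<gamma>"

lemma serret_frenet:
  assumes t: "t \<in> I"
  shows "(\<gamma> has_vector_derivative T t) (at t within I)"
    "(T has_vector_derivative \<kappa>1 t *\<^sub>R N1 t) (at t within I)"
    "(N1 has_vector_derivative - \<kappa>1 t *\<^sub>R T t + \<kappa>2 t *\<^sub>R N2 t) (at t within I)"
    "(N2 has_vector_derivative - \<kappa>2 t *\<^sub>R N1 t + \<kappa>3 t *\<^sub>R N3 t) (at t within I)"
    "(N3 has_vector_derivative - \<kappa>3 t *\<^sub>R N2 t) (at t within I)"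
  using smooth_deriv[OF smooth_gamma t] smooth_deriv[OF smooth_T t] smooth_deriv[OF smooth_N1 t]
    smooth_deriv[OF smooth_N2 t] smooth_deriv[OF smooth_N3 t] frenet[OF t]
  by (simp_all add: D_gamma unit_speed t frenet_equations_def)

lemma curvature_pos: "t \<in> I \<Longrightarrow> \<kappa>1 t > 0" "t \<in> I \<Longrightarrow> \<kappa>2 t > 0"
  using frenet[of t] by (auto simp: frenet_equations_def)

text \<open>
  The first derivative of the curve shifted along \<open>N1\<close> has no component along \<open>N1\<close>, and neither has
  the second one for second mates. So this formula yields both the second and the third derivative.
\<close>

lemma frame_deriv:
  assumes t: "t \<in> I"
    and d: "(a has_vector_derivative a') (at t within I)" "(b has_vector_derivative b') (at t within I)"
      "(c has_vector_derivative c') (at t within I)"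
  shows "((\<lambda>t. a t *\<^sub>R T t + b t *\<^sub>R N2 t + c t *\<^sub>R N3 t) has_vector_derivative
     a' *\<^sub>R T t + (a t * \<kappa>1 t - b t * \<kappa>2 t) *\<^sub>R N1 t + (b' - c t * \<kappa>3 t) *\<^sub>R N2 t
       + (c' + b t * \<kappa>3 t) *\<^sub>R N3 t) (at t within I)"
proof -
  note s = bounded_bilinear.has_vector_derivative[OF bounded_bilinear_scaleR]
  have "((\<lambda>t. a t *\<^sub>R T t + b t *\<^sub>R N2 t + c t *\<^sub>R N3 t) has_vector_derivative
     a t *\<^sub>R (\<kappa>1 t *\<^sub>R N1 t) + a' *\<^sub>R T t
     + (b t *\<^sub>R (- \<kappa>2 t *\<^sub>R N1 t + \<kappa>3 t *\<^sub>R N3 t) + b' *\<^sub>R N2 t)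
     + (c t *\<^sub>R (- \<kappa>3 t *\<^sub>R N2 t) + c' *\<^sub>R N3 t)) (at t within I)"
    by (intro has_vector_derivative_add s serret_frenet t d)
  then show ?thesis by (simp add: algebra_simps)
qed

end

section \<open>The curve shifted along its first normal\<close>

locale normal_shift = unit_speed_curve +
  fixes l :: real
  assumes l_nonzero: "l \<noteq> 0"
begin

abbreviation "\<beta> \<equiv> (\<lambda>s. \<gamma> s + l *\<^sub>R N1 s)"

lemma \<kappa>_deriv:
  assumes "t \<in> I"
  shows "(\<kappa>1 has_vector_derivative D \<kappa>1 t) (at t within I)"
    "(\<kappa>2 has_vector_derivative D \<kappa>2 t) (at t within I)"
    "(\<kappa>3 has_vector_derivative D \<kappa>3 t) (at t within I)"
    "(D \<kappa>1 has_vector_derivative D (D \<kappa>1) t) (at t within I)"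
    "(D \<kappa>2 has_vector_derivative D (D \<kappa>2) t) (at t within I)"
  by (intro smooth_deriv smooth_D smooth_curvature assms)+

lemmas mult_deriv = bounded_bilinear.has_vector_derivative[OF bounded_bilinear_mult]

lemma smooth_\<beta>: "smooth_on I \<beta>"
  by (intro smooth_add smooth_scaleR smooth_const smooth_gamma smooth_N1)

lemma D_\<beta>:
  assumes t: "t \<in> I"
  shows "D \<beta> t = (1 - l * \<kappa>1 t) *\<^sub>R T t + (l * \<kappa>2 t) *\<^sub>R N2 t"
proof -
  have "(\<beta> has_vector_derivative
      T t + (l *\<^sub>R (- \<kappa>1 t *\<^sub>R T t + \<kappa>2 t *\<^sub>R N2 t) + 0 *\<^sub>R N1 t)) (at t within I)"
    by (intro has_vector_derivative_add bounded_bilinear.has_vector_derivative[OF bounded_bilinear_scaleR]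
        has_vector_derivative_const serret_frenet t)
  then show ?thesis by (subst D_eqI[OF t]) (auto simp: algebra_simps)
qed

lemma D2_\<beta>:
  assumes t: "t \<in> I"
  shows "D (D \<beta>) t = (- l * D \<kappa>1 t) *\<^sub>R T t
     + (\<kappa>1 t - l * ((\<kappa>1 t)\<^sup>2 + (\<kappa>2 t)\<^sup>2)) *\<^sub>R N1 t
     + (l * D \<kappa>2 t) *\<^sub>R N2 t + (l * \<kappa>2 t * \<kappa>3 t) *\<^sub>R N3 t"
proof -
  have a: "((\<lambda>t. 1 - l * \<kappa>1 t) has_vector_derivative 0 - (l * D \<kappa>1 t + 0 * \<kappa>1 t)) (at t within I)"
    and b: "((\<lambda>t. l * \<kappa>2 t) has_vector_derivative l * D \<kappa>2 t + 0 * \<kappa>2 t) (at t within I)"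
    by (intro has_vector_derivative_diff mult_deriv has_vector_derivative_const \<kappa>_deriv t)+
  have "D (D \<beta>) t = D (\<lambda>t. (1 - l * \<kappa>1 t) *\<^sub>R T t + (l * \<kappa>2 t) *\<^sub>R N2 t + 0 *\<^sub>R N3 t) t"
    by (rule D_cong[OF _ t]) (simp add: D_\<beta>)
  also note D_eqI[OF t frame_deriv[OF t a b has_vector_derivative_const[of 0]]]
  finally show ?thesis by (simp add: algebra_simps power2_eq_square)
qed

lemma D2_\<beta>_N1:
  "t \<in> I \<Longrightarrow> D (D \<beta>) t \<bullet> N1 t = \<kappa>1 t - l * ((\<kappa>1 t)\<^sup>2 + (\<kappa>2 t)\<^sup>2)"
  by (simp add: D2_\<beta> inner_add_left inner_diff_left)

definition "f1 s = l^2 * (D \<kappa>1 s)^2 * (\<kappa>2 s)^4 * (\<kappa>3 s)^2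
         + (1 - l * \<kappa>1 s)^2 * (D \<kappa>1 s)^2 * (\<kappa>2 s)^2 * (\<kappa>3 s)^2
         + (D \<kappa>1 s)^2 * ((1 - l * \<kappa>1 s) * D \<kappa>2 s + l * D \<kappa>1 s * \<kappa>2 s)^2"
definition "f2 s = \<kappa>2 s * (2 * (D \<kappa>2 s)^2 * \<kappa>3 s + \<kappa>2 s * D \<kappa>2 s * D \<kappa>3 s
                 - \<kappa>2 s * D (D \<kappa>2) s * \<kappa>3 s + (\<kappa>2 s)^2 * (\<kappa>3 s)^3)
         + \<kappa>1 s * (2 * D \<kappa>1 s * D \<kappa>2 s * \<kappa>3 s + D \<kappa>1 s * \<kappa>2 s * D \<kappa>3 s
                 - D (D \<kappa>1) s * \<kappa>2 s * \<kappa>3 s)"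

context
  assumes mannheim: "\<And>t. t \<in> I \<Longrightarrow> l * ((\<kappa>1 t)\<^sup>2 + (\<kappa>2 t)\<^sup>2) = \<kappa>1 t"
begin

text \<open>
  The relation holds on the whole parameter set and may therefore be differentiated.
\<close>

lemma mannheim_deriv:
  assumes t: "t \<in> I"
  shows "2 * l * (\<kappa>1 t * D \<kappa>1 t + \<kappa>2 t * D \<kappa>2 t) = D \<kappa>1 t"
proof -
  have "((\<lambda>t. l * (\<kappa>1 t * \<kappa>1 t + \<kappa>2 t * \<kappa>2 t)) has_vector_derivative
     l * ((\<kappa>1 t * D \<kappa>1 t + D \<kappa>1 t * \<kappa>1 t) + (\<kappa>2 t * D \<kappa>2 t + D \<kappa>2 t * \<kappa>2 t))
       + 0 * (\<kappa>1 t * \<kappa>1 t + \<kappa>2 t * \<kappa>2 t)) (at t within I)"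
    by (intro has_vector_derivative_add mult_deriv has_vector_derivative_const \<kappa>_deriv t)
  from D_eqI[OF t this] have "D (\<lambda>t. l * (\<kappa>1 t * \<kappa>1 t + \<kappa>2 t * \<kappa>2 t)) t
      = 2 * l * (\<kappa>1 t * D \<kappa>1 t + \<kappa>2 t * D \<kappa>2 t)"
    by (simp add: algebra_simps)
  moreover have "D (\<lambda>t. l * (\<kappa>1 t * \<kappa>1 t + \<kappa>2 t * \<kappa>2 t)) t = D \<kappa>1 t"
    by (rule D_cong[OF _ t]) (simp add: mannheim power2_eq_square[symmetric])
  ultimately show ?thesis by simp
qed

lemma D3_\<beta>:
  assumes t: "t \<in> I"
  shows "D (D (D \<beta>)) t = (- l * D (D \<kappa>1) t) *\<^sub>R T t
     - (D \<kappa>1 t / 2) *\<^sub>R N1 t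
     + (l * (D (D \<kappa>2) t - \<kappa>2 t * (\<kappa>3 t)\<^sup>2)) *\<^sub>R N2 t
     + (l * (2 * D \<kappa>2 t * \<kappa>3 t + \<kappa>2 t * D \<kappa>3 t)) *\<^sub>R N3 t"
proof -
  have a: "((\<lambda>t. (- l) * D \<kappa>1 t) has_vector_derivative (- l) * D (D \<kappa>1) t + 0 * D \<kappa>1 t) (at t within I)"
    and b: "((\<lambda>t. l * D \<kappa>2 t) has_vector_derivative l * D (D \<kappa>2) t + 0 * D \<kappa>2 t) (at t within I)"
    and c: "((\<lambda>t. l * \<kappa>2 t * \<kappa>3 t) has_vector_derivative
        (l * \<kappa>2 t) * D \<kappa>3 t + (l * D \<kappa>2 t + 0 * \<kappa>2 t) * \<kappa>3 t) (at t within I)"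
    by (intro mult_deriv has_vector_derivative_const \<kappa>_deriv t)+
  have "D (D (D \<beta>)) t =
      D (\<lambda>t. ((- l) * D \<kappa>1 t) *\<^sub>R T t + (l * D \<kappa>2 t) *\<^sub>R N2 t + (l * \<kappa>2 t * \<kappa>3 t) *\<^sub>R N3 t) t"
    by (rule D_cong[OF _ t]) (simp add: D2_\<beta> mannheim)
  also note D_eqI[OF t frame_deriv[OF t a b c]]
  also have "(- l) * D \<kappa>1 t * \<kappa>1 t - l * D \<kappa>2 t * \<kappa>2 t = - (D \<kappa>1 t / 2)"
    using mannheim_deriv[OF t] by (simp add: algebra_simps)
  finally show ?thesis by (simp add: algebra_simps power2_eq_square)
qed

text \<open>
  The coordinates of the first three derivatives in the Frenet frame of \<open>\<gamma>\<close> are known, so those of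
  their product are four-by-four determinants. The determinant for \<open>N1\<close> is that of the other three
  coordinates. In each of the other three, the column of \<open>N1\<close> has the single entry \<open>- \<kappa>1' / 2\<close>, from
  the third derivative, which leaves a minor of the first two derivatives.
\<close>

lemma W\<beta>:
  fixes t defines "w \<equiv> cross4 (D \<beta> t) (D (D \<beta>) t) (D (D (D \<beta>)) t)"
  assumes t: "t \<in> I"
  shows "\<kappa>1 t * (w \<bullet> N1 t) = l^3 * \<kappa>2 t * f2 t"
    and "4 * (w \<bullet> w) = 4 * (w \<bullet> N1 t)^2 + l^2 * f1 t"
proof -
  define x1 x2 x3 y1 y2 y3 z1 z2 where
    "x1 = \<kappa>1 t" "x2 = \<kappa>2 t" "x3 = \<kappa>3 t" "y1 = D \<kappa>1 t" "y2 = D \<kappa>2 t" "y3 = D \<kappa>3 t"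
    "z1 = D (D \<kappa>1) t" "z2 = D (D \<kappa>2) t"
  note abb = this[symmetric]
  have A: "D \<beta> t \<bullet> T t = 1 - l * x1" "D \<beta> t \<bullet> N1 t = 0" "D \<beta> t \<bullet> N2 t = l * x2" "D \<beta> t \<bullet> N3 t = 0"
    using t by (simp_all add: D_\<beta> inner_add_left inner_diff_left abb)
  have B: "D (D \<beta>) t \<bullet> T t = - l * y1" "D (D \<beta>) t \<bullet> N1 t = 0" "D (D \<beta>) t \<bullet> N2 t = l * y2"
     "D (D \<beta>) t \<bullet> N3 t = l * x2 * x3"
    using t mannheim[OF t] by (simp_all add: D2_\<beta> inner_add_left inner_diff_left abb)
  have C: "D (D (D \<beta>)) t \<bullet> T t = - l * z1" "D (D (D \<beta>)) t \<bullet> N1 t = - (y1 / 2)"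
    "D (D (D \<beta>)) t \<bullet> N2 t = l * (z2 - x2 * x3\<^sup>2)"
     "D (D (D \<beta>)) t \<bullet> N3 t = l * (2 * y2 * x3 + x2 * y3)"
    using t by (simp_all add: D3_\<beta> inner_add_left inner_diff_left abb)
  have w: "w \<bullet> x = det (\<chi> i. vector [vector [D \<beta> t, D (D \<beta>) t, D (D (D \<beta>)) t, x] $ i \<bullet> T t,
     vector [D \<beta> t, D (D \<beta>) t, D (D (D \<beta>)) t, x] $ i \<bullet> N1 t,
     vector [D \<beta> t, D (D \<beta>) t, D (D (D \<beta>)) t, x] $ i \<bullet> N2 t,
     vector [D \<beta> t, D (D \<beta>) t, D (D (D \<beta>)) t, x] $ i \<bullet> N3 t] :: real^4^4)" for x
    unfolding w_def cross4_inner by (rule det_positive_frame[OF frame[OF t]])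
  have w1: "w \<bullet> N1 t = (1 - l * x1) * (l^2 * (y2 * (2 * y2 * x3 + x2 * y3) - x2 * x3 * (z2 - x2 * x3\<^sup>2)))
      + l^3 * x2 * (y1 * (2 * y2 * x3 + x2 * y3) - z1 * x2 * x3)"
    unfolding w using t
    by (simp add: det_4 vector_4_rows A B C, simp add: algebra_simps power2_eq_square power3_eq_cube)
  have w0: "w \<bullet> T t = y1 / 2 * l^2 * x2^2 * x3"
    unfolding w using t by (simp add: det_4 vector_4_rows A B C power2_eq_square)
  have w2: "w \<bullet> N2 t = - (y1 / 2 * l * (1 - l * x1) * x2 * x3)"
    unfolding w using t by (simp add: det_4 vector_4_rows A B C power2_eq_square)
  have w3: "w \<bullet> N3 t = y1 / 2 * l * ((1 - l * x1) * y2 + l * y1 * x2)"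
    unfolding w using t by (simp add: det_4 vector_4_rows A B C power2_eq_square algebra_simps)
  \<comment> \<open>Multiplying by \<open>\<kappa>1\<close> makes this substitution possible and gives all terms the factor \<open>l\<^sup>3 \<kappa>2\<close>.\<close>
  have "x1 * (1 - l * x1) = l * x2^2"
    using mannheim[OF t] by (simp add: abb algebra_simps power2_eq_square)
  then show "\<kappa>1 t * (w \<bullet> N1 t) = l^3 * \<kappa>2 t * f2 t"
    unfolding w1 f2_def abb by algebra
  have "w \<bullet> w = (w \<bullet> T t)^2 + (w \<bullet> N1 t)^2 + (w \<bullet> N2 t)^2 + (w \<bullet> N3 t)^2"
    using arg_cong[OF positive_frame_expand[OF frame[OF t], of w], of "\<lambda>x. w \<bullet> x"]
    by (simp add: inner_add_right power2_eq_square)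
  then show "4 * (w \<bullet> w) = 4 * (w \<bullet> N1 t)^2 + l^2 * f1 t"
    unfolding w0 w2 w3 f1_def abb by (simp add: field_simps power2_eq_square) algebra
qed

end

theorem second_mates_iff:
  "nondegenerate_curve I \<beta> \<and> (\<forall>t\<in>I. N1 t = frenet_n2 I \<beta> t \<or> N1 t = - frenet_n2 I \<beta> t) \<longleftrightarrow>
   (\<forall>t\<in>I. l * ((\<kappa>1 t)\<^sup>2 + (\<kappa>2 t)\<^sup>2) = \<kappa>1 t \<and> f1 t > 0 \<and> f2 t = 0)"
    (is "?mates \<longleftrightarrow> ?cond")
proof
  let ?w = "\<lambda>t. cross4 (D \<beta> t) (D (D \<beta>) t) (D (D (D \<beta>)) t)"
  assume mates: ?mates
  then interpret \<beta>: frenet_curve I \<beta> by unfold_locales blast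
  have orth: "D (D \<beta>) t \<bullet> N1 t = 0" "?w t \<bullet> N1 t = 0" if "t \<in> I" for t
    using \<beta>.second_normal_iff[of t "N1 t"] mates that by auto
  have mannheim: "l * ((\<kappa>1 t)\<^sup>2 + (\<kappa>2 t)\<^sup>2) = \<kappa>1 t" if "t \<in> I" for t
    using orth(1)[OF that] D2_\<beta>_N1[OF that] by simp
  show ?cond
  proof (intro ballI conjI)
    fix t assume t: "t \<in> I"
    show "l * ((\<kappa>1 t)\<^sup>2 + (\<kappa>2 t)\<^sup>2) = \<kappa>1 t" by (rule mannheim[OF t])
    show "f2 t = 0"
      using W\<beta>(1)[OF mannheim t] orth(2)[OF t] l_nonzero curvature_pos[OF t] by simp
    have "4 * (?w t \<bullet> ?w t) = l^2 * f1 t"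
      using W\<beta>(2)[OF mannheim t] orth(2)[OF t] by simp
    moreover have "?w t \<bullet> ?w t > 0" using \<beta>.W_nonzero[OF t] by simp
    ultimately have "l^2 * f1 t > 0" by linarith
    then show "f1 t > 0" by (rule zero_less_mult_pos) (use l_nonzero in simp)
  qed
next
  let ?w = "\<lambda>t. cross4 (D \<beta> t) (D (D \<beta>) t) (D (D (D \<beta>)) t)"
  assume cond: ?cond
  then have mannheim: "l * ((\<kappa>1 t)\<^sup>2 + (\<kappa>2 t)\<^sup>2) = \<kappa>1 t" if "t \<in> I" for t
    using that by blast
  have w_N1: "?w t \<bullet> N1 t = 0" if t: "t \<in> I" for t
    using W\<beta>(1)[OF mannheim t] curvature_pos(1)[OF t] cond t by simp
  have w: "?w t \<noteq> 0" if t: "t \<in> I" for t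
  proof
    assume "?w t = 0"
    then have "l^2 * f1 t = 0" using W\<beta>(2)[OF mannheim t] w_N1[OF t] by simp
    then show False using cond t l_nonzero by auto
  qed
  have "D \<beta> t \<noteq> 0" if t: "t \<in> I" for t
  proof
    assume "D \<beta> t = 0"
    then have "D \<beta> t \<bullet> N2 t = 0" by simp
    then show False using D_\<beta>[OF t] t l_nonzero curvature_pos(2)[OF t] by (simp add: inner_add_left)
  qed
  then have nondeg: "nondegenerate_curve I \<beta>"
    using smooth_\<beta> w by (simp add: nondegenerate_curve_def eval_nat_numeral)
  then interpret \<beta>: frenet_curve I \<beta> by unfold_locales
  have "N1 t = frenet_n2 I \<beta> t \<or> N1 t = - frenet_n2 I \<beta> t" if t: "t \<in> I" for t
    using \<beta>.second_normal_iff[of t "N1 t"] w_N1[OF t] D2_\<beta>_N1[OF t] mannheim[OF t] t D_\<beta>[OF t]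
    by (simp add: inner_add_left)
  with nondeg show ?mates by blast
qed

end

section \<open>Characterization of second mates\<close>

theorem theorem2p7:
  fixes I :: "real set" and \<gamma> \<gamma>b :: "real \<Rightarrow> real^4" and l :: real
    and k1 k2 k3 k1' k2' k3' k1'' k2'' :: "real \<Rightarrow> real"
  assumes "is_interval I" and "interior I \<noteq> {}"
    and "nondegenerate_curve I \<gamma>"
    and "\<forall>s\<in>I. speed I \<gamma> s = 1"
    and "k1 = curvature1 I \<gamma>" and "k2 = curvature2 I \<gamma>" and "k3 = curvature3 I \<gamma>"
    and "k1' = deriv_on I k1" and "k2' = deriv_on I k2" and "k3' = deriv_on I k3"
    and "k1'' = deriv_on I k1'" and "k2'' = deriv_on I k2'"
    and "l \<noteq> 0"
    and "\<gamma>b = (\<lambda>s. \<gamma> s + l *\<^sub>R frenet_n1 I \<gamma> s)"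
  shows "second_mates_with I \<gamma> \<gamma>b (\<lambda>_. l) \<longleftrightarrow>
    (\<forall>s\<in>I.
       l * ((k1 s)^2 + (k2 s)^2) = k1 s \<and>
       l^2 * (k1' s)^2 * (k2 s)^4 * (k3 s)^2
         + (1 - l * k1 s)^2 * (k1' s)^2 * (k2 s)^2 * (k3 s)^2
         + (k1' s)^2 * ((1 - l * k1 s) * k2' s + l * k1' s * k2 s)^2 > 0 \<and>
       k2 s * (2 * (k2' s)^2 * k3 s + k2 s * k2' s * k3' s
                 - k2 s * k2'' s * k3 s + (k2 s)^2 * (k3 s)^3)
         + k1 s * (2 * k1' s * k2' s * k3 s + k1' s * k2 s * k3' s
                 - k1'' s * k2 s * k3 s) = 0)"
proof -
  interpret normal_shift I \<gamma> l
    by unfold_locales (use assms islimpt_interval in auto)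
  obtain s where s: "s \<in> I" using assms(2) interior_subset by blast
  then have "N1 s \<noteq> 0" using N1_unit[of s] by (metis inner_zero_left zero_neq_one)
  then have different: "\<exists>t\<in>I. \<gamma> t \<noteq> \<gamma>b t" using s assms(13,14) by auto
  have "second_mates_with I \<gamma> \<gamma>b (\<lambda>_. l) \<longleftrightarrow>
      nondegenerate_curve I \<beta> \<and> (\<forall>t\<in>I. N1 t = frenet_n2 I \<beta> t \<or> N1 t = - frenet_n2 I \<beta> t)"
    using different assms(3,14) smooth_const[of l] unfolding second_mates_with_def by auto
  then show ?thesis
    unfolding second_mates_iff f1_def f2_def assms(5-12) .
qed

end
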